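(* Let $d\ge 2$ and $N\ge 2$ be integers and let $K\subsetneq[0,1]^d$ be a closed $T_N$-invariant set. Then there exist a constant $c<1$, a finite collection $\mathcal V\subset\mathbb R^d\setminus\{0\}$ of directions, and sets $(E_v)_{v\in\mathcal V}$ such that \[K=\bigcup_{v\in\mathcal V}E_v\] and, for every $v\in\mathcal V$, the orthogonal projection of $E_v$ onto the line $\{tv:t\in\mathbb R\}$ has Hausdorff dimension $<c$.
   Context: $T_N$ denotes the $\times N$ map on the $d$-dimensional torus $\mathbb R^d/\mathbb Z^d$, identified with $[0,1]^d$: $T_N(x_1,\dots,x_d)=(Nx_1 \bmod 1,\dots,Nx_d\bmod 1)$. A set $K\subset[0,1]^d$ is $T_N$-invariant if $T_N(K)\subset K$ under this identification, i.e. for each $x\in K$ there is $y\in K$ with $y\equiv Nx \pmod{\mathbb Z^d}$. A direction is a non-zero vector $v\in\mathbb R^d$, and the projection in direction $v$ is the orthogonal projection onto the line spanned by $v$. *)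

theory Defs
  imports "HOL-Analysis.Analysis"
begin

section \<open>Hausdorff measure and Hausdorff dimension\<close>

text \<open>
  The case distinction fixes the usual conventions for \<open>diam(U)^s\<close>: the empty set never
  contributes, and \<open>0^0 = 1\<close> for nonempty \<open>U\<close> (whereas \<open>0 powr 0 = 0\<close> in the library).
\<close>
definition diam_power :: "real \<Rightarrow> 'a::metric_space set \<Rightarrow> ennreal" where
  "diam_power s U =
    (if U = {} then 0 else if s = 0 then 1 else ennreal (diameter U powr s))"

text \<open>
  Boundedness of the covering sets is required explicitly because \<^const>\<open>diameter\<close>
  takes the value \<open>0\<close> on unbounded sets. Finite covers are included, since the sets may be empty.
\<close>
definition hausdorff_premeasure :: "real \<Rightarrow> real \<Rightarrow> 'a::metric_space set \<Rightarrow> ennreal" where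
  "hausdorff_premeasure s \<delta> A =
    (INF U \<in> {U :: nat \<Rightarrow> 'a set. A \<subseteq> (\<Union>i. U i) \<and> (\<forall>i. bounded (U i) \<and> diameter (U i) \<le> \<delta>)}.
      \<Sum>i. diam_power s (U i))"

definition hausdorff_measure :: "real \<Rightarrow> 'a::metric_space set \<Rightarrow> ennreal" where
  "hausdorff_measure s A = (SUP \<delta> \<in> {0<..}. hausdorff_premeasure s \<delta> A)"

text \<open>With this convention the empty set has dimension \<open>0\<close>.\<close>
definition hausdorff_dim :: "'a::metric_space set \<Rightarrow> ereal" where
  "hausdorff_dim A = Inf {ereal s | s. 0 \<le> s \<and> hausdorff_measure s A = 0}"


section \<open>Orthogonal projection onto a line\<close>

definition line_proj :: "'a::real_inner \<Rightarrow> 'a \<Rightarrow> 'a" where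
  "line_proj v x = ((x \<bullet> v) / (v \<bullet> v)) *\<^sub>R v"

lemma line_proj_in_span: "line_proj v x \<in> span {v}"
  by (simp add: line_proj_def span_base span_scale)

lemma line_proj_orthogonal:
  assumes "v \<noteq> 0"
  shows "orthogonal (x - line_proj v x) v"
  using assms by (simp add: line_proj_def orthogonal_def inner_diff_left)


section \<open>Invariance under multiplication by \<open>N\<close> on the torus\<close>

text \<open>
  The torus is identified with the closed cube, so a point may have several representatives;
  \<open>K\<close> only has to contain one point congruent to \<open>N x\<close> modulo the integer lattice.
\<close>
definition times_invariant :: "nat \<Rightarrow> (real ^ 'n) set \<Rightarrow> bool" where
  "times_invariant N K \<longleftrightarrow> (\<forall>x\<in>K. \<exists>y\<in>K. \<forall>i. y $ i - real N * x $ i \<in> \<int>)"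

end

theory Submission
  imports Defs
begin

text \<open>
  Choose \<open>a\<close> in the open cube outside \<open>K\<close>. For large \<open>M\<close> the trigonometric polynomial
  \<open>\<Prod>i. ((1 + cos (2\<pi>(x i - a i))) / 2) ^ M\<close> is smaller on \<open>K\<close> than its constant coefficient, because
  the latter decays only polynomially in \<open>M\<close>. So on \<open>K\<close> a subconvex combination of finitely many
  functions \<open>cos (2\<pi> v \<bullet> (x - a))\<close> with nonzero integer vectors \<open>v\<close> stays below some \<open>-\<epsilon> < 0\<close>.
  Averaging along an orbit, every \<open>x \<in> K\<close> has a frequency \<open>v\<close> for which infinitely many Birkhoff
  averages of \<open>- cos (2\<pi>(t - v \<bullet> a))\<close> under \<open>t \<mapsto> N t\<close>, started at \<open>t = v \<bullet> x\<close>, are at least \<open>\<epsilon>\<close>.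
  As this observable has mean zero, such \<open>t\<close> lie in at most \<open>N^n exp(-\<delta> n)\<close> of the \<open>N\<close>-adic intervals
  of level \<open>n\<close> by an exponential moment bound, and hence form a set of dimension less than \<open>1\<close>, with a
  bound that depends only on \<open>\<epsilon>\<close> and \<open>N\<close>.
\<close>

section \<open>Null sets for the Hausdorff measure\<close>

lemma diam_power_le:
  assumes "0 < s" "bounded U" "diameter U \<le> r"
  shows "diam_power s U \<le> ennreal (r powr s)"
  using assms diameter_ge_0[of U]
  by (auto simp: diam_power_def intro!: ennreal_leI powr_mono2)

text \<open>The definition admits only sequences of covering sets; \<open>prod_decode\<close>
  flattens a cover arranged by level \<open>n\<close> and index \<open>i\<close> into one.\<close>

lemma hausdorff_premeasure_le:
  fixes U :: "nat \<Rightarrow> nat \<Rightarrow> 'a::metric_space set"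
  assumes "A \<subseteq> (\<Union>n i. U n i)"
    and "\<And>n i. bounded (U n i)" "\<And>n i. diameter (U n i) \<le> \<delta>"
  shows "hausdorff_premeasure s \<delta> A \<le> (\<Sum>n. \<Sum>i. diam_power s (U n i))"
proof -
  let ?W = "\<lambda>k. case_prod U (prod_decode k)" and ?h = "\<lambda>(n, i). diam_power s (U n i)"
  have "A \<subseteq> (\<Union>k. ?W k)"
  proof
    fix x assume "x \<in> A"
    then obtain n i where "x \<in> U n i" using assms(1) by auto
    then have "x \<in> ?W (prod_encode (n, i))" by simp
    then show "x \<in> (\<Union>k. ?W k)" by (rule UN_I[OF UNIV_I])
  qed
  moreover have "bounded (?W k) \<and> diameter (?W k) \<le> \<delta>" for k
    using assms(2,3) by (cases "prod_decode k") auto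
  ultimately have "?W \<in> {U. A \<subseteq> (\<Union>i. U i) \<and> (\<forall>i. bounded (U i) \<and> diameter (U i) \<le> \<delta>)}"
    unfolding mem_Collect_eq by (intro conjI[of "A \<subseteq> _"] allI)
  then have "hausdorff_premeasure s \<delta> A \<le> (\<Sum>k. diam_power s (?W k))"
    unfolding hausdorff_premeasure_def by (rule INF_lower)
  also have "\<dots> = (\<Sum>k. ?h (prod_decode k))"
    by (intro suminf_cong) (auto split: prod.split)
  also have "\<dots> = (\<Sum>n. \<Sum>i. diam_power s (U n i))"
    using suminf_ennreal_2dimen[of "\<lambda>n. \<Sum>i. diam_power s (U n i)" ?h] by (simp add: comp_def)
  finally show ?thesis .
qed

text \<open>A Borel-Cantelli argument: for every \<open>m\<close> the levels from \<open>m\<close>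
  on still cover \<open>A\<close>. For large \<open>m\<close> their sets have diameter below any
  given \<delta>, and their total cost is the tail of a convergent series.\<close>

lemma hausdorff_Cantelli:
  fixes U :: "nat \<Rightarrow> nat \<Rightarrow> 'a::metric_space set"
  assumes s: "0 < s"
    and cover: "\<And>x. x \<in> A \<Longrightarrow> \<exists>\<^sub>F n in sequentially. \<exists>i\<in>I n. x \<in> U n i"
    and fin: "\<And>n. finite (I n)"
    and bdd: "\<And>n i. bounded (U n i)"
    and diam: "\<And>n i. diameter (U n i) \<le> r n"
    and r: "r \<longlonglongrightarrow> 0"
    and summ: "summable (\<lambda>n. real (card (I n)) * r n powr s)"
  shows "hausdorff_measure s A = 0"
proof -
  define b where "b n = real (card (I n)) * r n powr s" for n
  have b: "0 \<le> b n" for n unfolding b_def by simp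
  have le_eps: "hausdorff_premeasure s \<delta> A \<le> 0 + ennreal \<eta>" if "\<delta> > 0" "\<eta> > 0" for \<delta> \<eta>
  proof -
    have "eventually (\<lambda>n. r n < \<delta>) sequentially"
      using r \<open>\<delta> > 0\<close> by (rule order_tendstoD)
    moreover have "(\<lambda>m. \<Sum>n. b (n + m)) \<longlonglongrightarrow> 0"
      using summ unfolding b_def[symmetric] by (rule suminf_exist_split2)
    then have "eventually (\<lambda>m. (\<Sum>n. b (n + m)) < \<eta>) sequentially"
      using \<open>\<eta> > 0\<close> by (rule order_tendstoD)
    ultimately obtain m where m: "\<And>n. n \<ge> m \<Longrightarrow> r n < \<delta>" "(\<Sum>n. b (n + m)) < \<eta>"
      unfolding eventually_sequentially by (metis le_cases order_refl order_trans)
    \<comment> \<open>Indices outside \<open>I (n + m)\<close> get the empty set, which costs 0, so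
      the inner series becomes a finite sum.\<close>
    define W where "W n i = (if i \<in> I (n + m) then U (n + m) i else {})" for n i
    have "A \<subseteq> (\<Union>n i. W n i)"
    proof
      fix x assume "x \<in> A"
      from cover[OF this] obtain n i where n: "n \<ge> m" "i \<in> I n" "x \<in> U n i"
        unfolding frequently_sequentially by blast
      then have "x \<in> W (n - m) i" by (simp add: W_def)
      then show "x \<in> (\<Union>n i. W n i)" by blast
    qed
    moreover have "bounded (W n i)" for n i
      using bdd by (simp add: W_def)
    moreover have "diameter (W n i) \<le> \<delta>" for n i
      using diam[of "n + m" i] m(1)[of "n + m"] \<open>\<delta> > 0\<close> by (simp add: W_def)
    ultimately have "hausdorff_premeasure s \<delta> A \<le> (\<Sum>n. \<Sum>i. diam_power s (W n i))"
      by (rule hausdorff_premeasure_le)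
    also have "\<dots> \<le> (\<Sum>n. ennreal (b (n + m)))"
    proof (intro suminf_le allI)
      fix n
      have "(\<Sum>i. diam_power s (W n i)) = (\<Sum>i\<in>I (n + m). diam_power s (W n i))"
        by (rule suminf_finite) (auto simp: fin W_def diam_power_def)
      also have "\<dots> \<le> (\<Sum>i\<in>I (n + m). ennreal (r (n + m) powr s))"
        by (intro sum_mono) (auto simp: W_def intro!: diam_power_le s bdd diam)
      also have "\<dots> = ennreal (b (n + m))"
        by (simp add: b_def ennreal_mult ennreal_of_nat_eq_real_of_nat)
      finally show "(\<Sum>i. diam_power s (W n i)) \<le> ennreal (b (n + m))" .
    qed auto
    also have "\<dots> = ennreal (\<Sum>n. b (n + m))"
      by (rule suminf_ennreal2) (use b summ in \<open>auto simp: b_def[symmetric] summable_iff_shift\<close>)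
    also have "\<dots> \<le> ennreal \<eta>" using m(2) by (intro ennreal_leI) simp
    finally show ?thesis by simp
  qed
  have "hausdorff_premeasure s \<delta> A \<le> 0" if "\<delta> > 0" for \<delta>
    by (rule ennreal_le_epsilon) (use that in \<open>rule le_eps\<close>)
  then show ?thesis
    unfolding hausdorff_measure_def by (intro antisym SUP_least) auto
qed

lemma hausdorff_dim_le:
  assumes "hausdorff_measure s A = 0" "0 \<le> s"
  shows "hausdorff_dim A \<le> ereal s"
  unfolding hausdorff_dim_def using assms by (intro Inf_lower) auto


section \<open>Large deviations of Birkhoff sums\<close>

text \<open>For negative \<open>x = - y\<close> the claim is inverted: the quadratic Taylor lower
  bound of \<open>exp y\<close> times \<open>1 - y + y^2\<close> is at least 1.\<close>

lemma exp_le_quadratic: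
  fixes x :: real
  assumes "\<bar>x\<bar> \<le> 1"
  shows "exp x \<le> 1 + x + x\<^sup>2"
proof (cases "x \<ge> 0")
  case True
  then show ?thesis using exp_bound[of x] assms by simp
next
  case False
  define y where "y = - x"
  have y: "0 \<le> y" "y \<le> 1" using False assms by (auto simp: y_def)
  have "1 = exp (- y) * exp y" by (simp flip: exp_add)
  have "1 + y + y\<^sup>2 / 2 \<le> exp y" using exp_lower_Taylor_quadratic[OF y(1)] .
  moreover have "1 \<le> (1 + y + y\<^sup>2 / 2) * (1 - y + y\<^sup>2)"
  proof -
    have "(1 + y + y\<^sup>2 / 2) * (1 - y + y\<^sup>2) - 1 = y\<^sup>2 * (1 + y + y\<^sup>2) / 2"
      by (simp add: field_simps power2_eq_square)
    moreover have "y\<^sup>2 * (1 + y + y\<^sup>2) / 2 \<ge> 0" using y by simp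
    ultimately show ?thesis by linarith
  qed
  moreover have "0 \<le> 1 - y + y\<^sup>2" using y by simp
  ultimately have "1 \<le> exp y * (1 - y + y\<^sup>2)"
    by (meson mult_right_mono order_trans)
  then have "exp (- y) \<le> 1 - y + y\<^sup>2"
    by (simp add: exp_minus field_simps)
  then show ?thesis by (simp add: y_def)
qed

text \<open>With \<open>M = N ^ n\<close> this splits a grid index into its leading digit and the
  rest, or a grid on \<open>[0, C)\<close> into its \<open>C\<close> periods.\<close>

lemma sum_grid_shift:
  fixes F :: "nat \<Rightarrow> 'b::comm_monoid_add"
  shows "(\<Sum>j<c * M. F j) = (\<Sum>d<c. \<Sum>j<M. F (d * M + j))"
proof -
  have "(\<Sum>j<c * M. F j) = (\<Sum>d<c. \<Sum>j = d * M..<d * M + M. F j)"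
    by (rule sum.nat_group[symmetric])
  also have "\<dots> = (\<Sum>d<c. \<Sum>j<M. F (d * M + j))"
  proof (rule sum.cong[OF refl])
    fix d
    show "sum F {d * M..<d * M + M} = (\<Sum>j<M. F (d * M + j))"
      using sum.shift_bounds_nat_ivl[of F 0 "d * M" M]
      by (simp add: add.commute atLeast0LessThan)
  qed
  finally show ?thesis .
qed

text \<open>The points \<open>(d + u) / N\<close> are the preimages of \<open>u\<close> under
  multiplication by \<open>N\<close> on the circle. So \<open>zero_mean\<close> says that the
  transfer operator kills the observable, which is stronger than a vanishing integral.\<close>

locale expanding_observable =
  fixes N :: nat and \<phi> :: "real \<Rightarrow> real" and L :: real
  assumes N: "2 \<le> N"
    and periodic: "\<phi> (t + 1) = \<phi> t"
    and abs_le_1: "\<bar>\<phi> t\<bar> \<le> 1"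
    and Lipschitz: "\<bar>\<phi> s - \<phi> t\<bar> \<le> L * \<bar>s - t\<bar>"
    and zero_mean: "(\<Sum>d<N. \<phi> ((real d + u) / real N)) = 0"
begin

definition birkhoff :: "nat \<Rightarrow> real \<Rightarrow> real" where
  "birkhoff n t = (\<Sum>k<n. \<phi> (real N ^ k * t))"

lemma L_nonneg: "0 \<le> L"
  using Lipschitz[of 1 0] by simp

lemma periodic_nat: "\<phi> (t + real m) = \<phi> t"
proof (induction m)
  case (Suc m)
  have "\<phi> (t + real (Suc m)) = \<phi> ((t + real m) + 1)" by (simp add: add.commute add.left_commute)
  then show ?case using periodic Suc by metis
qed simp

lemma birkhoff_add_nat: "birkhoff n (t + real m) = birkhoff n t"
  unfolding birkhoff_def
proof (intro sum.cong refl)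
  fix k
  have "real N ^ k * (t + real m) = real N ^ k * t + real (N ^ k * m)"
    by (simp add: distrib_left)
  then show "\<phi> (real N ^ k * (t + real m)) = \<phi> (real N ^ k * t)"
    by (metis periodic_nat)
qed

lemma birkhoff_Suc: "birkhoff (Suc n) t = \<phi> t + birkhoff n (real N * t)"
  unfolding birkhoff_def sum.lessThan_Suc_shift by (simp add: mult_ac)

lemma sum_exp_le:
  assumes "0 \<le> \<mu>" "\<mu> \<le> 1"
  shows "(\<Sum>d<N. exp (\<mu> * \<phi> ((real d + u) / real N))) \<le> real N * (1 + \<mu>\<^sup>2)"
proof -
  have "exp (\<mu> * \<phi> t) \<le> 1 + \<mu> * \<phi> t + \<mu>\<^sup>2" for t
  proof -
    have "\<bar>\<mu> * \<phi> t\<bar> \<le> 1 * 1"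
      unfolding abs_mult using assms abs_le_1 by (intro mult_mono) auto
    then have "exp (\<mu> * \<phi> t) \<le> 1 + \<mu> * \<phi> t + (\<mu> * \<phi> t)\<^sup>2"
      by (intro exp_le_quadratic) simp
    moreover have "(\<phi> t)\<^sup>2 \<le> 1" using abs_le_1[of t] by (simp add: abs_square_le_1)
    then have "(\<mu> * \<phi> t)\<^sup>2 \<le> \<mu>\<^sup>2"
      by (simp add: power_mult_distrib mult_left_le)
    ultimately show ?thesis by linarith
  qed
  then have "(\<Sum>d<N. exp (\<mu> * \<phi> ((real d + u) / real N)))
      \<le> (\<Sum>d<N. 1 + \<mu> * \<phi> ((real d + u) / real N) + \<mu>\<^sup>2)"
    by (intro sum_mono) blast
  also have "\<dots> = real N * (1 + \<mu>\<^sup>2)"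
    by (simp only: sum.distrib sum_distrib_left[symmetric] zero_mean) (simp add: algebra_simps)
  finally show ?thesis .
qed

text \<open>Averaging over the leading digit kills the linear term of the exponential, so the digits
  can be removed one at a time although the summands of a Birkhoff sum are not independent.\<close>

lemma exp_moment_le:
  assumes "0 \<le> \<mu>" "\<mu> \<le> 1"
  shows "(\<Sum>j<N ^ n. exp (\<mu> * birkhoff n (real j / real N ^ n))) \<le> (real N * (1 + \<mu>\<^sup>2)) ^ n"
proof (induction n)
  case 0
  then show ?case by (simp add: birkhoff_def)
next
  case (Suc n)
  have N0: "real N > 0" using N by simp
  \<comment> \<open>Multiplication by \<open>N\<close> turns the leading digit \<open>d\<close> into
    an integer translation, invisible to the remaining Birkhoff sum.\<close>
  have step: "birkhoff (Suc n) (real (d * N ^ n + j) / real N ^ Suc n)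
      = \<phi> ((real d + real j / real N ^ n) / real N) + birkhoff n (real j / real N ^ n)" for d j
  proof -
    have "real (d * N ^ n + j) / real N ^ Suc n = (real d + real j / real N ^ n) / real N"
      using N0 by (simp add: field_simps)
    moreover have "real N * ((real d + real j / real N ^ n) / real N) = real j / real N ^ n + real d"
      using N0 by simp
    ultimately show ?thesis by (simp only: birkhoff_Suc birkhoff_add_nat)
  qed
  have "(\<Sum>j<N ^ Suc n. exp (\<mu> * birkhoff (Suc n) (real j / real N ^ Suc n)))
      = (\<Sum>d<N. \<Sum>j<N ^ n. exp (\<mu> * birkhoff (Suc n) (real (d * N ^ n + j) / real N ^ Suc n)))"
    by (simp only: power_Suc sum_grid_shift)
  also have "\<dots> = (\<Sum>d<N. \<Sum>j<N ^ n. exp (\<mu> * birkhoff n (real j / real N ^ n))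
      * exp (\<mu> * \<phi> ((real d + real j / real N ^ n) / real N)))"
    by (simp only: step distrib_left exp_add mult.commute)
  also have "\<dots> = (\<Sum>j<N ^ n. exp (\<mu> * birkhoff n (real j / real N ^ n))
      * (\<Sum>d<N. exp (\<mu> * \<phi> ((real d + real j / real N ^ n) / real N))))"
    by (subst sum.swap) (simp add: sum_distrib_left)
  also have "\<dots> \<le> (\<Sum>j<N ^ n. exp (\<mu> * birkhoff n (real j / real N ^ n)) * (real N * (1 + \<mu>\<^sup>2)))"
    by (intro sum_mono mult_left_mono sum_exp_le assms) simp
  also have "\<dots> \<le> (real N * (1 + \<mu>\<^sup>2)) ^ n * (real N * (1 + \<mu>\<^sup>2))"
    unfolding sum_distrib_right[symmetric] by (intro mult_right_mono Suc.IH) simp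
  finally show ?case by (simp add: mult.commute)
qed

text \<open>Chernoff's bound: Markov's inequality for the exponential moment, with \<mu> =
  \<open>a / 2\<close> minimising \<open>\<mu>\<^sup>2 - \<mu> * a\<close>. Each of the
  \<open>C\<close> unit periods contributes the same moment.\<close>

lemma large_deviation:
  assumes "0 \<le> a" "a \<le> 1"
  shows "real (card {j. j < C * N ^ n \<and> a * real n \<le> birkhoff n (real j / real N ^ n)})
    \<le> real C * (real N ^ n * exp (- (a\<^sup>2 / 4 * real n)))"
proof -
  let ?J = "{j. j < C * N ^ n \<and> a * real n \<le> birkhoff n (real j / real N ^ n)}"
  define \<mu> where "\<mu> = a / 2"
  have \<mu>: "0 \<le> \<mu>" "\<mu> \<le> 1" using assms by (auto simp: \<mu>_def)
  let ?e = "\<lambda>j. exp (\<mu> * birkhoff n (real j / real N ^ n))"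
  have per: "?e (d * N ^ n + j) = ?e j" for d j
  proof -
    have "real (d * N ^ n + j) / real N ^ n = real j / real N ^ n + real d"
      using N by (simp add: field_simps)
    then show ?thesis by (simp only: birkhoff_add_nat)
  qed
  have "real (card ?J) * exp (\<mu> * (a * real n)) = (\<Sum>j\<in>?J. exp (\<mu> * (a * real n)))" by simp
  also have "\<dots> \<le> (\<Sum>j\<in>?J. ?e j)"
    using \<mu> by (intro sum_mono) (auto intro!: mult_left_mono)
  also have "\<dots> \<le> (\<Sum>j<C * N ^ n. ?e j)"
    by (intro sum_mono2) auto
  also have "\<dots> = real C * (\<Sum>j<N ^ n. ?e j)"
    by (subst sum_grid_shift) (simp only: per sum_constant card_lessThan)
  also have "\<dots> \<le> real C * (real N * (1 + \<mu>\<^sup>2)) ^ n"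
    by (intro mult_left_mono exp_moment_le \<mu>) simp
  also have "\<dots> \<le> real C * (real N * exp (\<mu>\<^sup>2)) ^ n"
    by (intro mult_left_mono power_mono) (auto intro!: add_nonneg_nonneg)
  also have "\<dots> = real C * (real N ^ n * exp (\<mu>\<^sup>2 * real n))"
    by (simp add: power_mult_distrib exp_of_nat_mult[symmetric] mult.commute)
  finally have "real (card ?J) \<le> real C * (real N ^ n * exp (\<mu>\<^sup>2 * real n)) / exp (\<mu> * (a * real n))"
    by (simp add: pos_le_divide_eq)
  also have "\<dots> = real C * (real N ^ n * exp (\<mu>\<^sup>2 * real n - \<mu> * (a * real n)))"
    by (simp add: exp_diff)
  also have "\<mu>\<^sup>2 * real n - \<mu> * (a * real n) = - (a\<^sup>2 / 4 * real n)"
    by (simp add: \<mu>_def power2_eq_square field_simps)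
  finally show ?thesis .
qed

text \<open>The errors of the summands grow geometrically with ratio \<open>N\<close>, so their sum
  is comparable to the last one. The bound is uniform in \<open>n\<close>: moving \<open>t\<close>
  to a nearby grid point costs a constant only.\<close>

lemma birkhoff_close:
  assumes "\<bar>s - t\<bar> \<le> 1 / real N ^ n"
  shows "\<bar>birkhoff n s - birkhoff n t\<bar> \<le> L"
proof -
  have N2: "real N \<ge> 2" using N by simp
  have geo: "(\<Sum>k<n. real N ^ k) \<le> real N ^ n"
  proof (induction n)
    case (Suc n)
    have "2 * real N ^ n \<le> real N * real N ^ n" using N2 by (intro mult_right_mono) auto
    then show ?case using Suc by simp
  qed simp
  have "\<bar>birkhoff n s - birkhoff n t\<bar> \<le> (\<Sum>k<n. \<bar>\<phi> (real N ^ k * s) - \<phi> (real N ^ k * t)\<bar>)"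
    unfolding birkhoff_def by (simp add: sum_subtractf[symmetric])
  also have "\<dots> \<le> (\<Sum>k<n. L * (real N ^ k * (1 / real N ^ n)))"
  proof (intro sum_mono)
    fix k
    have "\<bar>real N ^ k * s - real N ^ k * t\<bar> = real N ^ k * \<bar>s - t\<bar>"
      by (simp add: abs_mult right_diff_distrib[symmetric])
    also have "\<dots> \<le> real N ^ k * (1 / real N ^ n)"
      using assms by (intro mult_left_mono) auto
    finally show "\<bar>\<phi> (real N ^ k * s) - \<phi> (real N ^ k * t)\<bar> \<le> L * (real N ^ k * (1 / real N ^ n))"
      using Lipschitz L_nonneg by (meson mult_left_mono order_trans)
  qed
  also have "\<dots> = L * ((\<Sum>k<n. real N ^ k) / real N ^ n)"
    by (simp add: sum_distrib_left sum_divide_distrib)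
  also have "\<dots> \<le> L * 1"
    using geo N2 by (intro mult_left_mono L_nonneg) (simp add: divide_le_eq)
  finally show ?thesis by simp
qed

text \<open>At level \<open>n\<close> the cover consists of the images of those
  \<open>N\<close>-adic intervals whose left endpoint has a large Birkhoff sum. There are few of
  them by \<open>large_deviation\<close>, and the condition on \<open>s\<close> makes the total cost
  summable.\<close>

lemma hausdorff_measure_large_deviation:
  fixes f :: "real \<Rightarrow> 'a::metric_space"
  assumes a: "0 < a" "a \<le> 1" and s: "0 < s" "(1 - s) * ln (real N) < a\<^sup>2 / 16"
    and l: "0 < l" "\<And>t u. dist (f t) (f u) \<le> l * \<bar>t - u\<bar>"
    and A: "A \<subseteq> f ` {t. 0 \<le> t \<and> t < real C \<and> (\<exists>\<^sub>F n in sequentially. a * real n \<le> birkhoff n t)}"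
  shows "hausdorff_measure s A = 0"
proof (rule hausdorff_Cantelli[OF s(1)])
  \<comment> \<open>The threshold is halved to absorb the error \<open>L\<close> of passing to the
    endpoint, which works once \<open>n\<close> is at least \<open>2 * L / a\<close>. Hence the
    exponent \<open>(a / 2)^2 / 4 = a^2 / 16\<close>.\<close>
  let ?I = "\<lambda>n. {j. j < C * N ^ n \<and> a / 2 * real n \<le> birkhoff n (real j / real N ^ n)}"
  let ?U = "\<lambda>n i. f ` {real i / real N ^ n..(real i + 1) / real N ^ n}"
  let ?r = "\<lambda>n. l / real N ^ n"
  have N0: "real N > 0" and N1: "real N > 1" using N by auto
  have dist: "dist x y \<le> ?r n" if "x \<in> ?U n i" "y \<in> ?U n i" for n i x y
  proof -
    from that obtain t u where tu: "x = f t" "y = f u"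
      "t \<in> {real i / real N ^ n..(real i + 1) / real N ^ n}"
      "u \<in> {real i / real N ^ n..(real i + 1) / real N ^ n}" by blast
    then have "\<bar>t - u\<bar> \<le> 1 / real N ^ n"
      by (auto simp: add_divide_distrib abs_le_iff)
    then have "l * \<bar>t - u\<bar> \<le> l * (1 / real N ^ n)" using l(1) by (intro mult_left_mono) auto
    then show ?thesis using l(2)[of t u] tu by simp
  qed
  show "finite (?I n)" for n by simp
  show "bounded (?U n i)" for n i
  proof -
    have "?U n i \<noteq> {}" using N0 by (auto simp: divide_right_mono)
    then show ?thesis using dist unfolding bounded_def by blast
  qed
  show "diameter (?U n i) \<le> ?r n" for n i
  proof -
    have "?U n i \<noteq> {}" using N0 by (auto simp: divide_right_mono)
    then show ?thesis unfolding diameter_def by (auto intro!: cSUP_least dist)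
  qed
  show "?r \<longlonglongrightarrow> 0"
    using LIMSEQ_divide_realpow_zero[OF N1] .
  show "\<exists>\<^sub>F n in sequentially. \<exists>i\<in>?I n. x \<in> ?U n i" if "x \<in> A" for x
  proof -
    from that A obtain t where t: "x = f t" "0 \<le> t" "t < real C"
      and freq: "\<exists>\<^sub>F n in sequentially. a * real n \<le> birkhoff n t" by blast
    have "\<forall>\<^sub>F n in sequentially. 2 * L / a \<le> real n"
      using eventually_ge_at_top[of "nat \<lceil>2 * L / a\<rceil>"] by eventually_elim linarith
    then have "\<forall>\<^sub>F n in sequentially. a * real n \<le> birkhoff n t \<longrightarrow> (\<exists>i\<in>?I n. x \<in> ?U n i)"
    proof (rule eventually_mono, intro impI)
      fix n assume n: "2 * L / a \<le> real n" "a * real n \<le> birkhoff n t"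
      define i where "i = nat \<lfloor>t * real N ^ n\<rfloor>"
      have i: "real i \<le> t * real N ^ n" "t * real N ^ n < real i + 1"
        using t(2) by (simp_all add: i_def)
      have "real i < real C * real N ^ n"
        using i(1) t(3) N0 by (meson le_less_trans mult_strict_right_mono zero_less_power)
      then have "i < C * N ^ n" by (metis of_nat_less_iff of_nat_mult of_nat_power)
      moreover have mem: "real i / real N ^ n \<le> t" "t \<le> (real i + 1) / real N ^ n"
        using i N0 by (simp_all add: divide_le_eq le_divide_eq)
      then have "\<bar>real i / real N ^ n - t\<bar> \<le> 1 / real N ^ n"
        by (simp add: add_divide_distrib)
      then have "birkhoff n t - L \<le> birkhoff n (real i / real N ^ n)"
        using birkhoff_close by fastforce
      then have "a / 2 * real n \<le> birkhoff n (real i / real N ^ n)"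
        using n a(1) by (simp add: field_simps)
      ultimately show "\<exists>i\<in>?I n. x \<in> ?U n i"
        using mem t(1) by (intro bexI[of _ i]) auto
    qed
    with freq show ?thesis by (rule frequently_rev_mp)
  qed
  show "summable (\<lambda>n. real (card (?I n)) * ?r n powr s)"
  proof (rule summable_comparison_test')
    let ?q = "exp ((1 - s) * ln (real N) - a\<^sup>2 / 16)"
    show "summable (\<lambda>n. real C * l powr s * ?q ^ n)"
      using s by (intro summable_mult summable_geometric) simp
    fix n :: nat
    have r_powr: "?r n powr s = l powr s / exp (s * (ln (real N) * real n))"
      using N0 l(1) by (simp add: powr_divide) (simp add: powr_def ln_realpow mult.commute)
    have N_pow: "real N ^ n = exp (ln (real N) * real n)"
      using N0 by (metis exp_ln exp_of_nat2_mult)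
    have "real (card (?I n)) * ?r n powr s
        \<le> real C * (real N ^ n * exp (- ((a / 2)\<^sup>2 / 4 * real n))) * ?r n powr s"
      using large_deviation[of "a / 2" C n] a by (intro mult_right_mono) auto
    also have "\<dots> = real C * (exp (ln (real N) * real n) * exp (- ((a / 2)\<^sup>2 / 4 * real n)))
        * (l powr s / exp (s * (ln (real N) * real n)))"
      by (simp only: r_powr) (simp only: N_pow)
    also have "\<dots> = real C * l powr s * exp (ln (real N) * real n + - ((a / 2)\<^sup>2 / 4 * real n)
          - s * (ln (real N) * real n))"
      by (simp only: exp_diff exp_add) simp
    also have "ln (real N) * real n + - ((a / 2)\<^sup>2 / 4 * real n) - s * (ln (real N) * real n)
        = ((1 - s) * ln (real N) - a\<^sup>2 / 16) * real n"
      by (simp add: algebra_simps power_divide)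
    also have "exp \<dots> = ?q ^ n" by (rule exp_of_nat2_mult)
    finally show "norm (real (card (?I n)) * ?r n powr s) \<le> real C * l powr s * ?q ^ n"
      by simp
  qed
qed

end

section \<open>Cosines as observables for multiplication by \<open>N\<close>\<close>

text \<open>Multiplied by \<open>2 * sin (pi / N)\<close>, which is positive for \<open>N\<close> at
  least 2, the sum telescopes over a full period of the sine.\<close>

lemma sum_cos_shifted_roots_eq_0:
  fixes N :: nat
  assumes "2 \<le> N"
  shows "(\<Sum>d<N. cos (2 * pi * ((real d + u) / real N) - \<beta>)) = 0"
proof -
  define h where "h = pi / real N"
  define g where "g d = sin (2 * h * (real d + u) - \<beta> - h)" for d :: nat
  have N0: "real N \<ge> 2" using assms by simp
  have "0 < h" "h < pi" using N0 by (auto simp: h_def divide_less_eq)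
  then have h: "sin h > 0" by (rule sin_gt_zero)
  have "2 * sin h * cos (2 * pi * ((real d + u) / real N) - \<beta>) = g (Suc d) - g d" for d
  proof -
    let ?x = "2 * h * (real d + u) - \<beta>"
    have "g (Suc d) - g d = sin (?x + h) - sin (?x - h)"
      by (simp add: g_def algebra_simps)
    also have "\<dots> = 2 * sin h * cos ?x" by (simp add: sin_add sin_diff)
    finally show ?thesis by (simp add: h_def)
  qed
  then have "2 * sin h * (\<Sum>d<N. cos (2 * pi * ((real d + u) / real N) - \<beta>)) = (\<Sum>d<N. g (Suc d) - g d)"
    by (simp add: sum_distrib_left)
  also have "\<dots> = g N - g 0" by (rule sum_lessThan_telescope)
  also have "2 * h * (real N + u) - \<beta> - h = (2 * h * u - \<beta> - h) + 2 * pi"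
    using N0 by (simp add: h_def field_simps)
  then have "g N - g 0 = 0" by (simp only: g_def sin_periodic) simp
  finally show ?thesis using h by simp
qed

lemma abs_cos_diff_le: "\<bar>cos x - cos y\<bar> \<le> \<bar>x - y\<bar>" for x y :: real
proof -
  have "\<bar>cos x - cos y\<bar> = 2 * (\<bar>sin ((x + y) / 2)\<bar> * \<bar>sin ((y - x) / 2)\<bar>)"
    by (simp add: cos_diff_cos abs_mult)
  also have "\<dots> \<le> 2 * (1 * \<bar>(y - x) / 2\<bar>)"
    by (intro mult_left_mono mult_mono abs_sin_x_le_abs_x abs_sin_le_one) auto
  finally show ?thesis by simp
qed

text \<open>The frequency vector enters only through the variable \<open>t\<close>, and the phase is
  arbitrary, so one Lipschitz constant serves all directions.\<close>

lemma expanding_observable_cos: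
  assumes "2 \<le> N"
  shows "expanding_observable N (\<lambda>t. - cos (2 * pi * t - \<beta>)) (2 * pi)"
proof
  show "2 \<le> N" by fact
  show "- cos (2 * pi * (t + 1) - \<beta>) = - cos (2 * pi * t - \<beta>)" for t
  proof -
    have "2 * pi * (t + 1) - \<beta> = (2 * pi * t - \<beta>) + 2 * pi" by (simp add: algebra_simps)
    then show ?thesis by (simp only: cos_periodic)
  qed
  show "\<bar>- cos (2 * pi * t - \<beta>)\<bar> \<le> 1" for t by simp
  show "\<bar>- cos (2 * pi * s - \<beta>) - - cos (2 * pi * t - \<beta>)\<bar> \<le> 2 * pi * \<bar>s - t\<bar>" for s t
  proof -
    have "\<bar>- cos (2 * pi * s - \<beta>) - - cos (2 * pi * t - \<beta>)\<bar> \<le> \<bar>2 * pi * (s - t)\<bar>"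
      using abs_cos_diff_le[of "2 * pi * t - \<beta>" "2 * pi * s - \<beta>"]
      by (simp add: algebra_simps abs_minus_commute)
    then show ?thesis by (simp add: abs_mult)
  qed
  show "(\<Sum>d<N. - cos (2 * pi * ((real d + u) / real N) - \<beta>)) = 0" for u
    using sum_cos_shifted_roots_eq_0[OF assms] by (simp add: sum_negf)
qed


section \<open>A trigonometric polynomial that is small on a proper closed set\<close>

text \<open>The base equals \<open>cis (- \<theta>) * (cis \<theta> + 1)^2 / 4\<close>, so the
  binomial theorem applies. All coefficients are nonnegative, and the constant one, at
  \<open>j = M\<close>, is the central binomial coefficient over \<open>4 ^ M\<close>.\<close>

lemma cos_power_expansion:
  "complex_of_real (((1 + cos \<theta>) / 2) ^ M)
    = (\<Sum>j\<le>2 * M. complex_of_real (real ((2 * M) choose j) / 4 ^ M) * cis ((real j - real M) * \<theta>))"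
proof -
  have "complex_of_real ((1 + cos \<theta>) / 2) = cis (- \<theta>) * (cis \<theta> + 1)\<^sup>2 / 4"
  proof -
    have "cis (- \<theta>) * (cis \<theta> + 1)\<^sup>2 = cis (- \<theta>) * cis \<theta> * cis \<theta> + 2 * (cis (- \<theta>) * cis \<theta>) + cis (- \<theta>)"
      by (simp add: power2_eq_square algebra_simps)
    also have "\<dots> = cis \<theta> + 2 + cis (- \<theta>)" by (simp add: cis_mult)
    also have "\<dots> = complex_of_real (2 + 2 * cos \<theta>)" by (simp add: complex_eq_iff)
    finally show ?thesis by simp
  qed
  then have "complex_of_real (((1 + cos \<theta>) / 2) ^ M) = (cis (- \<theta>) * (cis \<theta> + 1)\<^sup>2 / 4) ^ M"
    by (metis of_real_power)
  also have "\<dots> = cis (- \<theta>) ^ M * (cis \<theta> + 1) ^ (2 * M) / 4 ^ M"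
    by (simp add: power_mult_distrib power_divide power_mult)
  also have "\<dots> = (\<Sum>j\<le>2 * M. cis (- \<theta>) ^ M * (of_nat ((2 * M) choose j) * cis \<theta> ^ j) / 4 ^ M)"
    by (simp add: binomial_ring sum_distrib_left sum_divide_distrib)
  also have "\<dots> = (\<Sum>j\<le>2 * M. complex_of_real (real ((2 * M) choose j) / 4 ^ M) * cis ((real j - real M) * \<theta>))"
  proof (intro sum.cong refl)
    fix j
    have "cis (- \<theta>) ^ M * cis \<theta> ^ j = cis ((real j - real M) * \<theta>)"
      unfolding Complex.DeMoivre cis_mult by (intro arg_cong[where f = cis]) (simp add: algebra_simps)
    then show "cis (- \<theta>) ^ M * (of_nat ((2 * M) choose j) * cis \<theta> ^ j) / 4 ^ M
      = complex_of_real (real ((2 * M) choose j) / 4 ^ M) * cis ((real j - real M) * \<theta>)"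
      by (simp add: mult_ac)
  qed
  finally show ?thesis .
qed

lemma prod_cis: "finite A \<Longrightarrow> (\<Prod>i\<in>A. cis (f i)) = cis (\<Sum>i\<in>A. f i)"
  by (induction A rule: finite_induct) (auto simp: cis_mult)

text \<open>The one-variable expansions are multiplied out; \<open>g\<close> selects one term per
  coordinate, which gives the integer frequency vector with entries \<open>g i - M\<close>.\<close>

lemma prod_cos_power_expansion:
  fixes \<theta> :: "'n::finite \<Rightarrow> real"
  shows "(\<Prod>i\<in>UNIV. (1 + cos (\<theta> i)) / 2) ^ M
    = (\<Sum>g\<in>UNIV \<rightarrow>\<^sub>E {..2 * M}. (\<Prod>i\<in>UNIV. real ((2 * M) choose g i) / 4 ^ M)
        * cos (\<Sum>i\<in>UNIV. (real (g i) - real M) * \<theta> i))"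
proof -
  have "complex_of_real ((\<Prod>i\<in>UNIV. (1 + cos (\<theta> i)) / 2) ^ M)
      = (\<Prod>i\<in>UNIV. complex_of_real (((1 + cos (\<theta> i)) / 2) ^ M))"
    by (simp only: prod_power_distrib of_real_prod)
  also have "\<dots> = (\<Prod>i\<in>UNIV. \<Sum>j\<le>2 * M.
      complex_of_real (real ((2 * M) choose j) / 4 ^ M) * cis ((real j - real M) * \<theta> i))"
    by (simp only: cos_power_expansion)
  also have "\<dots> = (\<Sum>g\<in>UNIV \<rightarrow>\<^sub>E {..2 * M}. \<Prod>i\<in>UNIV.
      complex_of_real (real ((2 * M) choose g i) / 4 ^ M) * cis ((real (g i) - real M) * \<theta> i))"
    by (rule prod_sum_PiE) auto
  also have "\<dots> = (\<Sum>g\<in>UNIV \<rightarrow>\<^sub>E {..2 * M}. complex_of_real (\<Prod>i\<in>UNIV. real ((2 * M) choose g i) / 4 ^ M)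
        * cis (\<Sum>i\<in>UNIV. (real (g i) - real M) * \<theta> i))"
    by (simp only: prod.distrib of_real_prod prod_cis[OF finite])
  finally have "Re (complex_of_real ((\<Prod>i\<in>UNIV. (1 + cos (\<theta> i)) / 2) ^ M)) = Re \<dots>" by (rule arg_cong)
  then show ?thesis by (simp only: Re_complex_of_real Re_sum) (simp del: of_real_prod)
qed

text \<open>The normalised central binomial coefficient is at least \<open>1 / (2 * M)\<close>, so
  its \<open>d\<close>-th power decays at most polynomially, whereas \<open>q ^ M\<close> decays
  exponentially.\<close>

lemma exists_power_less_central_binomial:
  fixes q :: real
  assumes "0 \<le> q" "q < 1"
  shows "\<exists>M. q ^ M < (real ((2 * M) choose M) / 4 ^ M) ^ d"
proof -
  \<comment> \<open>The root has order \<open>d + 1\<close> rather than \<open>d\<close>: the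
    surplus factor \<open>p ^ M\<close> makes the final inequality strict, also for
    \<open>d = 0\<close>.\<close>
  define p where "p = root (Suc d) q"
  have p: "0 \<le> p" "p < 1" "p ^ Suc d = q" using assms by (auto simp: p_def simp del: power_Suc)
  have "(\<lambda>n. real n * p ^ n) \<longlonglongrightarrow> 0" using p by (intro powser_times_n_limit_0) simp
  then have "eventually (\<lambda>n. real n * p ^ n < 1 / 2) sequentially" by (rule order_tendstoD) simp
  then have "eventually (\<lambda>n. real n * p ^ n < 1 / 2 \<and> n > 0) sequentially"
    using eventually_gt_at_top[of 0] by eventually_elim simp
  then obtain M where M: "real M * p ^ M < 1 / 2" "M > 0"
    by (auto simp: eventually_sequentially)
  have pM: "p ^ M < 1 / (2 * real M)" using M by (simp add: field_simps)
  have "1 / (2 * real M) = 4 ^ M / (2 * real M) / 4 ^ M" by simp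
  also have "\<dots> \<le> real ((2 * M) choose M) / 4 ^ M"
    using central_binomial_lower_bound[OF M(2)] by (intro divide_right_mono) auto
  finally have b: "p ^ M < real ((2 * M) choose M) / 4 ^ M" using pM by simp
  have "q ^ M = (p ^ M) ^ d * p ^ M" by (simp flip: p(3) power_mult power_add add: algebra_simps)
  also have "\<dots> < (real ((2 * M) choose M) / 4 ^ M) ^ d"
  proof (cases "p = 0")
    case True
    then show ?thesis using M(2) b by (simp add: power_0_left)
  next
    case False
    then have "(p ^ M) ^ d * p ^ M < (p ^ M) ^ d * 1"
      using p M(2) by (intro mult_strict_left_mono) (auto simp: power_less_one_iff)
    also have "\<dots> \<le> (real ((2 * M) choose M) / 4 ^ M) ^ d"
      using b p(1) by (simp add: power_mono)
    finally show ?thesis .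
  qed
  finally show ?thesis by blast
qed

section \<open>Separating a proper closed subset of the cube from an interior point\<close>

lemma exists_missing_point_in_box:
  fixes K :: "'a::euclidean_space set"
  assumes "K \<subset> cbox l u" "closed K" "box l u \<noteq> {}"
  obtains a where "a \<in> box l u" "a \<notin> K"
proof -
  have "\<not> box l u \<subseteq> K"
    using assms closure_minimal[of "box l u" K] by (auto simp: closure_box)
  then show ?thesis using that by blast
qed

text \<open>By compactness the product attains its maximum on \<open>K\<close>. The value 1 would
  need a maximiser that differs from \<open>a\<close> by an integer vector; since \<open>a\<close>
  is interior, all coordinate differences are below 1 in modulus, so that maximiser would be
  \<open>a\<close> itself.\<close>

lemma exists_bound_prod_cos:
  fixes K :: "(real ^ 'n) set"
  assumes K: "compact K" "K \<subseteq> cbox 0 1" and a: "a \<in> box 0 1" "a \<notin> K"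
  obtains q where "0 \<le> q" "q < 1"
    "\<And>x. x \<in> K \<Longrightarrow> (\<Prod>i\<in>UNIV. (1 + cos (2 * pi * (x $ i - a $ i))) / 2) \<le> q"
proof (cases "K = {}")
  case True
  then show ?thesis using that[of 0] by simp
next
  case False
  let ?h = "\<lambda>x. \<Prod>i\<in>UNIV. (1 + cos (2 * pi * (x $ i - a $ i))) / 2"
  have nn: "0 \<le> (1 + cos t) / 2" for t :: real using cos_ge_minus_one[of t] by (simp del: cos_ge_minus_one)
  have le: "(1 + cos t) / 2 \<le> 1" for t :: real by simp
  have "continuous_on K ?h" by (auto intro!: continuous_intros)
  then obtain z where z: "z \<in> K" "\<And>x. x \<in> K \<Longrightarrow> ?h x \<le> ?h z"
    using continuous_attains_sup[OF K(1) False] by blast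
  have "z \<noteq> a" using z(1) a(2) by blast
  then obtain i where i: "z $ i \<noteq> a $ i" by (auto simp: vec_eq_iff)
  have "cos (2 * pi * (z $ i - a $ i)) \<noteq> 1"
  proof
    assume "cos (2 * pi * (z $ i - a $ i)) = 1"
    then obtain m :: int where "2 * pi * (z $ i - a $ i) = real_of_int m * 2 * pi"
      by (auto simp: cos_one_2pi_int)
    then have m: "z $ i - a $ i = real_of_int m" by simp
    have "0 \<le> z $ i" "z $ i \<le> 1" using K(2) z(1) by (auto simp: mem_box_cart)
    moreover have "0 < a $ i" "a $ i < 1" using a(1) by (auto simp: mem_box_cart)
    ultimately have "\<bar>real_of_int m\<bar> < 1" using m by linarith
    then have "m = 0" by linarith
    then show False using m i by simp
  qed
  then have "(1 + cos (2 * pi * (z $ i - a $ i))) / 2 < 1"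
    using cos_le_one[of "2 * pi * (z $ i - a $ i)"] by (simp add: order_less_le)
  moreover have "?h z \<le> (1 + cos (2 * pi * (z $ i - a $ i))) / 2"
  proof -
    have "?h z = (1 + cos (2 * pi * (z $ i - a $ i))) / 2
        * (\<Prod>i\<in>UNIV - {i}. (1 + cos (2 * pi * (z $ i - a $ i))) / 2)"
      by (rule prod.remove) auto
    also have "\<dots> \<le> (1 + cos (2 * pi * (z $ i - a $ i))) / 2 * 1"
      by (intro mult_left_mono prod_le_1 conjI nn le)
    finally show ?thesis by simp
  qed
  ultimately have "?h z < 1" by linarith
  moreover have "0 \<le> ?h z" by (intro prod_nonneg nn)
  ultimately show ?thesis using z(2) that by blast
qed

text \<open>On \<open>K\<close> the \<open>M\<close>-th power of the product is at most
  \<open>q ^ M\<close>, which is less than its constant coefficient \<open>W z\<close>. Hence the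
  nonconstant terms add up to at most \<open>q ^ M - W z\<close>.\<close>

lemma cosine_polynomial_negative:
  fixes K :: "(real ^ 'n) set"
  assumes K: "K \<subset> cbox 0 1" "closed K"
  obtains a :: "real ^ 'n" and V w \<epsilon> where "finite V" "0 \<notin> V" "\<And>v i. v \<in> V \<Longrightarrow> v $ i \<in> \<int>"
    "0 < \<epsilon>" "\<epsilon> \<le> 1" "\<And>v. 0 \<le> w v" "sum w V \<le> 1"
    "\<And>x. x \<in> K \<Longrightarrow> (\<Sum>v\<in>V. w v * cos (2 * pi * (x \<bullet> v) - 2 * pi * (a \<bullet> v))) \<le> - \<epsilon>"
proof -
  have "box 0 (1 :: real ^ 'n) \<noteq> {}"
    by (simp add: interval_ne_empty_cart)
  then obtain a where a: "a \<in> box 0 1" "a \<notin> K"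
    using exists_missing_point_in_box[OF K] by blast
  have "compact K"
    using K compact_eq_bounded_closed bounded_cbox bounded_subset by blast
  then obtain q where q: "0 \<le> q" "q < 1"
    "\<And>x. x \<in> K \<Longrightarrow> (\<Prod>i\<in>UNIV. (1 + cos (2 * pi * (x $ i - a $ i))) / 2) \<le> q"
    using exists_bound_prod_cos[of K a] K(1) a by blast
  obtain M where M: "q ^ M < (real ((2 * M) choose M) / 4 ^ M) ^ CARD('n)"
    using exists_power_less_central_binomial[OF q(1,2)] by blast
  define P :: "('n \<Rightarrow> nat) set" where "P = UNIV \<rightarrow>\<^sub>E {..2 * M}"
  define W where "W g = (\<Prod>i\<in>UNIV. real ((2 * M) choose g i) / 4 ^ M)" for g :: "'n \<Rightarrow> nat"
  define z :: "'n \<Rightarrow> nat" where "z = (\<lambda>_. M)"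
  define vec :: "('n \<Rightarrow> nat) \<Rightarrow> real ^ 'n" where "vec g = (\<chi> i. real (g i) - real M)" for g
  \<comment> \<open>The floor inverts \<open>vec\<close>, so that the coefficients become indexed by
    frequency vectors.\<close>
  define w where "w v = W (\<lambda>i. nat \<lfloor>v $ i + real M\<rfloor>)" for v
  have finP: "finite P" unfolding P_def by (intro finite_PiE) auto
  have zP: "z \<in> P" by (auto simp: P_def z_def)
  have W0: "0 \<le> W g" for g unfolding W_def by (intro prod_nonneg) auto
  have w_vec: "w (vec g) = W g" for g by (simp add: w_def vec_def)
  have inj: "inj_on vec S" for S
    by (auto intro!: inj_onI simp: vec_def vec_eq_iff fun_eq_iff)
  have vec0: "vec g = 0 \<longleftrightarrow> g = z" for g
    by (auto simp: vec_def vec_eq_iff z_def fun_eq_iff)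
  have expansion: "(\<Prod>i\<in>UNIV. (1 + cos (\<theta> i)) / 2) ^ M
      = W z + (\<Sum>g\<in>P - {z}. W g * cos (\<Sum>i\<in>UNIV. (real (g i) - real M) * \<theta> i))" for \<theta>
    unfolding prod_cos_power_expansion W_def[symmetric] P_def[symmetric]
    by (subst sum.remove[OF finP zP]) (simp add: z_def)
  \<comment> \<open>At angle zero every cosine is 1, so the coefficients sum to 1.\<close>
  have sumW: "1 = W z + sum W (P - {z})"
    using expansion[of "\<lambda>_. 0"] by simp
  have Wz: "W z = (real ((2 * M) choose M) / 4 ^ M) ^ CARD('n)"
    by (simp add: W_def z_def)
  show ?thesis
  proof (rule that[of "vec ` (P - {z})" "W z - q ^ M" w a])
    show "finite (vec ` (P - {z}))" using finP by simp
    show "0 \<notin> vec ` (P - {z})" using vec0 by (metis DiffE imageE singletonI)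
    show "v $ i \<in> \<int>" if "v \<in> vec ` (P - {z})" for v i
      using that by (auto simp: vec_def)
    show "0 < W z - q ^ M" using M Wz by simp
    have "0 \<le> sum W (P - {z})" by (intro sum_nonneg W0)
    moreover have "0 \<le> q ^ M" using q(1) by simp
    ultimately show "W z - q ^ M \<le> 1" using sumW by linarith
    show "0 \<le> w v" for v unfolding w_def by (rule W0)
    show "sum w (vec ` (P - {z})) \<le> 1"
      using sumW W0[of z] by (simp add: sum.reindex[OF inj] w_vec)
    show "(\<Sum>v\<in>vec ` (P - {z}). w v * cos (2 * pi * (x \<bullet> v) - 2 * pi * (a \<bullet> v))) \<le> - (W z - q ^ M)"
      if "x \<in> K" for x
    proof -
      let ?\<theta> = "\<lambda>i. 2 * pi * (x $ i - a $ i)"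
      have "2 * pi * (x \<bullet> vec g) - 2 * pi * (a \<bullet> vec g) = (\<Sum>i\<in>UNIV. (real (g i) - real M) * ?\<theta> i)" for g
        unfolding inner_vec_def vec_def sum_distrib_left sum_subtractf[symmetric]
        by (rule sum.cong) (simp_all add: algebra_simps)
      then have "(\<Sum>v\<in>vec ` (P - {z}). w v * cos (2 * pi * (x \<bullet> v) - 2 * pi * (a \<bullet> v)))
          = (\<Prod>i\<in>UNIV. (1 + cos (?\<theta> i)) / 2) ^ M - W z"
        unfolding expansion by (simp add: sum.reindex[OF inj] w_vec)
      also have "(\<Prod>i\<in>UNIV. (1 + cos (?\<theta> i)) / 2) ^ M \<le> q ^ M"
      proof (intro power_mono q(3) that prod_nonneg)
        show "0 \<le> (1 + cos t) / 2" for t :: real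
          using cos_ge_minus_one[of t] by (simp del: cos_ge_minus_one)
      qed
      finally show ?thesis by simp
    qed
  qed
qed


section \<open>Decomposition of invariant sets\<close>

lemma times_invariant_power:
  assumes "times_invariant N K" "x \<in> K"
  shows "\<exists>y\<in>K. \<forall>i. y $ i - real N ^ k * x $ i \<in> \<int>"
proof (induction k)
  case 0
  then show ?case using assms(2) by (intro bexI[of _ x]) auto
next
  case (Suc k)
  then obtain y where y: "y \<in> K" "\<And>i. y $ i - real N ^ k * x $ i \<in> \<int>" by blast
  obtain z where z: "z \<in> K" "\<And>i. z $ i - real N * y $ i \<in> \<int>"
    using assms(1) y(1) unfolding times_invariant_def by blast
  have "z $ i - real N ^ Suc k * x $ i \<in> \<int>" for i
  proof -
    have "z $ i - real N ^ Suc k * x $ i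
        = (z $ i - real N * y $ i) + of_nat N * (y $ i - real N ^ k * x $ i)"
      by (simp add: algebra_simps)
    then show ?thesis using y(2)[of i] z(2)[of i] by (metis Ints_add Ints_mult Ints_of_nat)
  qed
  then show ?case using z(1) by blast
qed

lemma cos_add_2pi_Ints:
  assumes "m \<in> \<int>"
  shows "cos (t + 2 * pi * m) = cos t"
proof -
  obtain k :: int where "m = of_int k" using assms by (rule Ints_cases)
  then show ?thesis by (simp add: cos_add sin_int_2pin cos_int_2pin)
qed

text \<open>Since \<open>v\<close> is integral, the cosines depend on points modulo the lattice
  only, so \<open>neg\<close> holds along the whole orbit of \<open>x\<close>. Summed over
  \<open>n\<close> steps, a combination of Birkhoff sums of total weight at most 1 reaches
  \<open>\<epsilon> * n\<close>, so one of them does. The choice of \<open>v\<close> may depend on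
  \<open>n\<close>.\<close>

lemma exists_frequency_along_orbit:
  fixes K :: "(real ^ 'n) set"
  assumes inv: "times_invariant N K"
    and V: "finite V" "\<And>v i. v \<in> V \<Longrightarrow> v $ i \<in> \<int>" "\<And>v. 0 \<le> w v" "sum w V \<le> 1" and \<epsilon>: "0 < \<epsilon>"
    and neg: "\<And>x. x \<in> K \<Longrightarrow> (\<Sum>v\<in>V. w v * cos (2 * pi * (x \<bullet> v) - \<beta> v)) \<le> - \<epsilon>"
    and x: "x \<in> K"
  shows "\<exists>v\<in>V. \<epsilon> * real n \<le> (\<Sum>k<n. - cos (2 * pi * (real N ^ k * (x \<bullet> v)) - \<beta> v))"
proof (rule ccontr)
  let ?B = "\<lambda>v. \<Sum>k<n. - cos (2 * pi * (real N ^ k * (x \<bullet> v)) - \<beta> v)"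
  assume "\<not> (\<exists>v\<in>V. \<epsilon> * real n \<le> ?B v)"
  then have less: "?B v < \<epsilon> * real n" if "v \<in> V" for v using that by force
  have orbit: "(\<Sum>v\<in>V. w v * cos (2 * pi * (real N ^ k * (x \<bullet> v)) - \<beta> v)) \<le> - \<epsilon>" for k
  proof -
    obtain y where y: "y \<in> K" "\<And>i. y $ i - real N ^ k * x $ i \<in> \<int>"
      using times_invariant_power[OF inv x] by blast
    have "cos (2 * pi * (y \<bullet> v) - \<beta> v) = cos (2 * pi * (real N ^ k * (x \<bullet> v)) - \<beta> v)"
      if "v \<in> V" for v
    proof -
      have "y \<bullet> v - real N ^ k * (x \<bullet> v) = (\<Sum>i\<in>UNIV. (y $ i - real N ^ k * x $ i) * v $ i)"
        by (simp add: inner_vec_def sum_distrib_left sum_subtractf algebra_simps)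
      also have "\<dots> \<in> \<int>" using y(2) V(2)[OF that] by (intro Ints_sum Ints_mult)
      finally have "cos ((2 * pi * (real N ^ k * (x \<bullet> v)) - \<beta> v)
          + 2 * pi * (y \<bullet> v - real N ^ k * (x \<bullet> v))) = cos (2 * pi * (real N ^ k * (x \<bullet> v)) - \<beta> v)"
        by (rule cos_add_2pi_Ints)
      then show ?thesis by (simp add: algebra_simps)
    qed
    then show ?thesis using neg[OF y(1)] by simp
  qed
  have "n \<noteq> 0"
  proof
    assume "n = 0"
    then have "V = {}" using less by auto
    then show False using neg[OF x] \<epsilon> by simp
  qed
  have "real n * \<epsilon> \<le> (\<Sum>k<n. \<Sum>v\<in>V. w v * - cos (2 * pi * (real N ^ k * (x \<bullet> v)) - \<beta> v))"
  proof -
    have "\<epsilon> \<le> (\<Sum>v\<in>V. w v * - cos (2 * pi * (real N ^ k * (x \<bullet> v)) - \<beta> v))" for k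
      using orbit[of k] by (simp add: sum_negf)
    from sum_bounded_below[OF this, of "{..<n}"] show ?thesis by (simp only: card_lessThan)
  qed
  also have "\<dots> = (\<Sum>v\<in>V. w v * ?B v)"
    by (subst sum.swap) (simp add: sum_distrib_left)
  finally have lower: "real n * \<epsilon> \<le> (\<Sum>v\<in>V. w v * ?B v)" .
  \<comment> \<open>A positive weight is what makes the next comparison strict.\<close>
  have "\<exists>v\<in>V. w v > 0"
  proof (rule ccontr)
    assume "\<not> (\<exists>v\<in>V. w v > 0)"
    then have "w v = 0" if "v \<in> V" for v using that V(3)[of v] by force
    then have "(\<Sum>v\<in>V. w v * ?B v) = 0" by simp
    then show False using lower \<epsilon> \<open>n \<noteq> 0\<close> by (simp add: mult_le_0_iff)
  qed
  then have "(\<Sum>v\<in>V. w v * ?B v) < (\<Sum>v\<in>V. w v * (\<epsilon> * real n))"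
    using V(1,3) less
    by (intro sum_strict_mono_ex1 ballI mult_left_mono) (auto intro!: less_imp_le mult_strict_left_mono)
  also have "\<dots> = sum w V * (\<epsilon> * real n)" by (simp add: sum_distrib_right)
  also have "\<dots> \<le> 1 * (\<epsilon> * real n)" using V(4) \<epsilon> by (intro mult_right_mono) auto
  finally show False using lower by (simp add: mult.commute)
qed

text \<open>The projection of \<open>x\<close> is a Lipschitz function of
  \<open>x \<bullet> v\<close>. Adding the integer \<open>R\<close> moves this parameter into
  \<open>[0, 2 * R)\<close> and leaves the Birkhoff sums unchanged.\<close>

lemma hausdorff_measure_line_proj:
  fixes A :: "'a::real_inner set"
  assumes N: "2 \<le> N" and \<epsilon>: "0 < \<epsilon>" "\<epsilon> \<le> 1" and s: "0 < s" "(1 - s) * ln (real N) < \<epsilon>\<^sup>2 / 16"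
    and v: "v \<noteq> 0" and bdd: "bounded A"
    and freq: "\<And>x. x \<in> A \<Longrightarrow> \<exists>\<^sub>F n in sequentially.
      \<epsilon> * real n \<le> (\<Sum>k<n. - cos (2 * pi * (real N ^ k * (x \<bullet> v)) - \<beta>))"
  shows "hausdorff_measure s (line_proj v ` A) = 0"
proof -
  interpret expanding_observable N "\<lambda>t. - cos (2 * pi * t - \<beta>)" "2 * pi"
    by (rule expanding_observable_cos[OF N])
  obtain b where b: "\<And>x. x \<in> A \<Longrightarrow> norm x \<le> b" using bdd unfolding bounded_iff by blast
  obtain R :: nat where R: "b * norm v < real R" using reals_Archimedean2 by blast
  have xv: "\<bar>x \<bullet> v\<bar> < real R" if "x \<in> A" for x
  proof -
    have "\<bar>x \<bullet> v\<bar> \<le> norm x * norm v" by (rule Cauchy_Schwarz_ineq2)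
    also have "\<dots> \<le> b * norm v" by (intro mult_right_mono b that) simp
    finally show ?thesis using R by linarith
  qed
  define f where "f t = ((t - real R) / (v \<bullet> v)) *\<^sub>R v" for t
  show ?thesis
  proof (rule hausdorff_measure_large_deviation[OF \<epsilon> s])
    show "0 < norm v / (v \<bullet> v)" using v by simp
    show "dist (f t) (f u) \<le> norm v / (v \<bullet> v) * \<bar>t - u\<bar>" for t u
    proof -
      have "f t - f u = ((t - u) / (v \<bullet> v)) *\<^sub>R v"
        by (simp add: f_def scaleR_diff_left[symmetric] diff_divide_distrib[symmetric])
      then show ?thesis by (simp add: dist_norm mult.commute)
    qed
    show "line_proj v ` A \<subseteq> f ` {t. 0 \<le> t \<and> t < real (2 * R) \<and>
        (\<exists>\<^sub>F n in sequentially. \<epsilon> * real n \<le> birkhoff n t)}"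
    proof
      fix p assume "p \<in> line_proj v ` A"
      then obtain x where x: "x \<in> A" "p = line_proj v x" by blast
      have "p = f (x \<bullet> v + real R)" by (simp add: x(2) f_def line_proj_def)
      moreover have "0 \<le> x \<bullet> v + real R" "x \<bullet> v + real R < real (2 * R)"
        using xv[OF x(1)] by (auto simp: abs_less_iff)
      moreover have "\<exists>\<^sub>F n in sequentially. \<epsilon> * real n \<le> birkhoff n (x \<bullet> v + real R)"
        unfolding birkhoff_add_nat using freq[OF x(1)] by (simp add: birkhoff_def)
      ultimately show "p \<in> f ` {t. 0 \<le> t \<and> t < real (2 * R) \<and>
        (\<exists>\<^sub>F n in sequentially. \<epsilon> * real n \<le> birkhoff n t)}" by blast
    qed
  qed
qed

theorem theorem1p1:
  fixes N :: nat and K :: "(real ^ 'n) set"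
  assumes "CARD('n) \<ge> 2" and "N \<ge> 2"
    and "K \<subset> cbox 0 1"
    and "closed K"
    and "times_invariant N K"
  shows "\<exists>(c::real) (V :: (real ^ 'n) set) (E :: real ^ 'n \<Rightarrow> (real ^ 'n) set).
    c < 1 \<and> finite V \<and> 0 \<notin> V \<and> K = (\<Union>v\<in>V. E v) \<and>
    (\<forall>v\<in>V. hausdorff_dim (line_proj v ` E v) < ereal c)"
proof -
  obtain a :: "real ^ 'n" and V w \<epsilon> where V: "finite V" "0 \<notin> V" "\<And>v i. v \<in> V \<Longrightarrow> v $ i \<in> \<int>"
    and \<epsilon>: "0 < \<epsilon>" "\<epsilon> \<le> 1" and w: "\<And>v. 0 \<le> w v" "sum w V \<le> 1"
    and neg: "\<And>x. x \<in> K \<Longrightarrow> (\<Sum>v\<in>V. w v * cos (2 * pi * (x \<bullet> v) - 2 * pi * (a \<bullet> v))) \<le> - \<epsilon>"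
    by (rule cosine_polynomial_negative[OF assms(3,4)]) (rule that)
  define Q where "Q v x n \<longleftrightarrow>
    \<epsilon> * real n \<le> (\<Sum>k<n. - cos (2 * pi * (real N ^ k * (x \<bullet> v)) - 2 * pi * (a \<bullet> v)))" for v x n
  \<comment> \<open>The frequency found for \<open>x\<close> varies with \<open>n\<close>, but
    \<open>V\<close> is finite, so by pigeonhole some \<open>v\<close> recurs for infinitely many
    \<open>n\<close>.\<close>
  define E where "E v = {x \<in> K. \<exists>\<^sub>F n in sequentially. Q v x n}" for v
  have lnN: "ln (real N) > 0" using assms(2) by simp
  \<comment> \<open>The constant 32 instead of 16 makes the condition on \<open>s\<close> strict;
    the maximum with \<open>1 / 2\<close> keeps \<open>s\<close> positive. Nothing here depends on
    \<open>v\<close>.\<close>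
  define s where "s = max (1 / 2) (1 - \<epsilon>\<^sup>2 / (32 * ln (real N)))"
  have s: "0 < s" "s < 1" using \<epsilon> lnN by (auto simp: s_def)
  have "(1 - s) * ln (real N) \<le> \<epsilon>\<^sup>2 / (32 * ln (real N)) * ln (real N)"
    using lnN by (intro mult_right_mono) (auto simp: s_def)
  also have "\<dots> < \<epsilon>\<^sup>2 / 16" using lnN \<epsilon> by simp
  finally have s': "(1 - s) * ln (real N) < \<epsilon>\<^sup>2 / 16" .
  have "\<exists>v\<in>V. x \<in> E v" if x: "x \<in> K" for x
  proof -
    have "\<exists>v\<in>V. Q v x n" for n
      using exists_frequency_along_orbit[OF assms(5) V(1,3) w \<epsilon>(1) neg x] unfolding Q_def by blast
    then have "\<exists>\<^sub>F n in sequentially. \<exists>v\<in>V. Q v x n"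
      by (intro eventually_frequently) auto
    from frequently_bex_finite[OF V(1) this] show ?thesis using x by (simp add: E_def)
  qed
  then have "K = (\<Union>v\<in>V. E v)" by (auto simp: E_def)
  \<comment> \<open>The midpoint of \<open>s\<close> and 1 serves as \<open>c\<close>, since the
    measure only yields dimension at most \<open>s\<close>.\<close>
  moreover have "hausdorff_dim (line_proj v ` E v) < ereal ((1 + s) / 2)" if "v \<in> V" for v
  proof -
    have "bounded (E v)"
      by (rule bounded_subset[OF bounded_cbox[of 0 1]]) (use assms(3) in \<open>auto simp: E_def\<close>)
    then have "hausdorff_measure s (line_proj v ` E v) = 0"
      using V(2) that
      by (intro hausdorff_measure_line_proj[OF assms(2) \<epsilon> s(1) s']) (auto simp: E_def Q_def)
    then have "hausdorff_dim (line_proj v ` E v) \<le> ereal s" using s by (intro hausdorff_dim_le) auto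
    also have "ereal s < ereal ((1 + s) / 2)" using s by simp
    finally show ?thesis .
  qed
  moreover have "(1 + s) / 2 < 1" using s by simp
  ultimately show ?thesis using V(1,2) by blast
qed

end
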